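(* For a group $G$, the following conditions are equivalent. (i) $G$ is locally finite. (ii) For every nonempty alphabet $A$, every bijective cellular automaton $A^G\to A^G$ is reversible. (iii) For every infinite alphabet $A$, every bijective cellular automaton $A^G\to A^G$ is reversible. (iv) For some infinite alphabet $A$, every bijective cellular automaton $A^G\to A^G$ is reversible. Equivalently, if $G$ is not locally finite, then for every infinite alphabet $A$ there exists a bijective cellular automaton $A^G\to A^G$ whose inverse is not a cellular automaton.
   Context: A group $G$ is locally finite if every finitely generated subgroup of $G$ is finite. An alphabet is a nonempty set (possibly infinite). For a group $G$ and an alphabet $A$, $A^G$ is the set of all maps (configurations) $x\colon G\to A$, with the left shift action $(gx)(h)=x(g^{-1}h)$ for $g,h\in G$. A map $\tau\colon A^G\to A^G$ is a cellular automaton if there exist a finite subset $M\subset G$ (called a memory set for $\tau$) and a map $\mu\colon A^M\to A$ such that $\tau(x)(g)=\mu\bigl((g^{-1}x)|_M\bigr)$ for all $x\in A^G$ and $g\in G$. A bijective cellular automaton $\tau\colon A^G\to A^G$ is reversible if its inverse map $\tau^{-1}\colon A^G\to A^G$ is also a cellular automaton. *)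

theory Defs
  imports "HOL-Algebra.Generated_Groups" "HOL-Library.FuncSet"
begin

definition finitely_generated_subgroup :: "('g, 'm) monoid_scheme \<Rightarrow> 'g set \<Rightarrow> bool" where
  "finitely_generated_subgroup G H \<longleftrightarrow>
     subgroup H G \<and> (\<exists>S. finite S \<and> S \<subseteq> carrier G \<and> H = generate G S)"

definition locally_finite :: "('g, 'm) monoid_scheme \<Rightarrow> bool" where
  "locally_finite G \<longleftrightarrow> (\<forall>H. finitely_generated_subgroup G H \<longrightarrow> finite H)"

text \<open>
  Groups and alphabets are carrier sets. A map from \<open>X\<close> to \<open>A\<close> is represented by its unique
  extensional representative, an element of \<open>X \<rightarrow>\<^sub>E A\<close>, so equality of such functions is
  equality of maps on \<open>X\<close>.
\<close>

definition configurations :: "('g, 'm) monoid_scheme \<Rightarrow> 'a set \<Rightarrow> ('g \<Rightarrow> 'a) set" where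
  "configurations G A = (carrier G \<rightarrow>\<^sub>E A)"

definition shift :: "('g, 'm) monoid_scheme \<Rightarrow> 'g \<Rightarrow> ('g \<Rightarrow> 'a) \<Rightarrow> ('g \<Rightarrow> 'a)" where
  "shift G g x = (\<lambda>h\<in>carrier G. x (inv\<^bsub>G\<^esub> g \<otimes>\<^bsub>G\<^esub> h))"

text \<open>
  Only the values of \<open>\<tau>\<close> on configurations matter; its values elsewhere in the ambient
  function type are unconstrained and irrelevant to every notion below.
\<close>

definition cellular_automaton ::
  "('g, 'm) monoid_scheme \<Rightarrow> 'a set \<Rightarrow> (('g \<Rightarrow> 'a) \<Rightarrow> ('g \<Rightarrow> 'a)) \<Rightarrow> bool" where
  "cellular_automaton G A \<tau> \<longleftrightarrow>
     \<tau> \<in> configurations G A \<rightarrow> configurations G A \<and>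
     (\<exists>M \<mu>. finite M \<and> M \<subseteq> carrier G \<and> \<mu> \<in> (M \<rightarrow>\<^sub>E A) \<rightarrow> A \<and>
        (\<forall>x\<in>configurations G A. \<forall>g\<in>carrier G.
           \<tau> x g = \<mu> (restrict (shift G (inv\<^bsub>G\<^esub> g) x) M)))"

definition bijective_cellular_automaton ::
  "('g, 'm) monoid_scheme \<Rightarrow> 'a set \<Rightarrow> (('g \<Rightarrow> 'a) \<Rightarrow> ('g \<Rightarrow> 'a)) \<Rightarrow> bool" where
  "bijective_cellular_automaton G A \<tau> \<longleftrightarrow>
     cellular_automaton G A \<tau> \<and> bij_betw \<tau> (configurations G A) (configurations G A)"

definition reversible ::
  "('g, 'm) monoid_scheme \<Rightarrow> 'a set \<Rightarrow> (('g \<Rightarrow> 'a) \<Rightarrow> ('g \<Rightarrow> 'a)) \<Rightarrow> bool" where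
  "reversible G A \<tau> \<longleftrightarrow>
     bijective_cellular_automaton G A \<tau> \<and>
     cellular_automaton G A (the_inv_into (configurations G A) \<tau>)"

end

theory Submission
  imports Defs "HOL-Library.Countable"
begin

text \<open>
  If \<open>G\<close> is locally finite, the subgroup \<open>H\<close> generated by a memory set of a bijective cellular
  automaton is finite, and the automaton acts independently on the cosets \<open>g H\<close>; hence so does
  its inverse, which therefore has memory set \<open>H\<close>.

  If a finite set generates an infinite subgroup of \<open>G\<close>, let \<open>T\<close> be its closure under inverses and
  mark countably many letters with a height in \<open>nat\<close> and a bit. The automaton flips the bit at \<open>g\<close>
  iff, for some \<open>t \<in> T\<close>, the site \<open>g t\<close> has smaller height than \<open>g\<close> and bit \<open>True\<close>. Heights
  do not change, so the automaton can be undone by recursion on the height. But a configuration whose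
  heights decrease along a geodesic from \<open>\<one>\<close> to \<open>h\<close> lets the inverse transport a bit from \<open>h\<close> to
  \<open>\<one>\<close>, and \<open>h\<close> can be arbitrarily far away.
\<close>

section \<open>Cellular automata\<close>

lemma restrict_shift:
  assumes "group G" "g \<in> carrier G" "M \<subseteq> carrier G"
  shows "restrict (shift G (inv\<^bsub>G\<^esub> g) x) M = (\<lambda>m\<in>M. x (g \<otimes>\<^bsub>G\<^esub> m))"
proof -
  interpret group G by fact
  show ?thesis using assms by (auto simp: shift_def restrict_def subset_iff)
qed

text \<open>By \<open>restrict_shift\<close> the pattern seen at g is m \<mapsto> x (g m), so the
  local rule at g simply reads the sites g m.\<close>

lemma cellular_automaton_iff:
  assumes "group G"
  shows "cellular_automaton G A \<tau> \<longleftrightarrow>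
     \<tau> \<in> configurations G A \<rightarrow> configurations G A \<and>
     (\<exists>M \<mu>. finite M \<and> M \<subseteq> carrier G \<and> \<mu> \<in> (M \<rightarrow>\<^sub>E A) \<rightarrow> A \<and>
        (\<forall>x\<in>configurations G A. \<forall>g\<in>carrier G. \<tau> x g = \<mu> (\<lambda>m\<in>M. x (g \<otimes>\<^bsub>G\<^esub> m))))"
  unfolding cellular_automaton_def
  by (intro conj_cong refl ex_cong1) (auto simp: restrict_shift[OF assms])

lemma configurations_eqI:
  assumes "x \<in> configurations G A" "y \<in> configurations G A" "\<And>g. g \<in> carrier G \<Longrightarrow> x g = y g"
  shows "x = y"
  using assms unfolding configurations_def by (rule PiE_ext)

lemma shift_configurations:
  assumes "group G" "g \<in> carrier G" "x \<in> configurations G A"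
  shows "shift G g x \<in> configurations G A"
proof -
  interpret group G by fact
  show ?thesis using assms by (auto simp: shift_def configurations_def)
qed

lemma cellular_automaton_shift:
  assumes "group G" "cellular_automaton G A \<tau>" "g \<in> carrier G" "x \<in> configurations G A"
  shows "\<tau> (shift G g x) = shift G g (\<tau> x)"
proof (rule configurations_eqI)
  interpret group G by fact
  from assms(1,2) obtain M \<mu> where \<tau>: "\<tau> \<in> configurations G A \<rightarrow> configurations G A"
    and M: "M \<subseteq> carrier G"
    and eq: "\<And>x g. x \<in> configurations G A \<Longrightarrow> g \<in> carrier G \<Longrightarrow> \<tau> x g = \<mu> (\<lambda>m\<in>M. x (g \<otimes>\<^bsub>G\<^esub> m))"
    by (auto simp: cellular_automaton_iff)
  note sh = shift_configurations[OF assms(1,3)]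
  show "\<tau> (shift G g x) \<in> configurations G A" "shift G g (\<tau> x) \<in> configurations G A"
    using \<tau> assms(4) sh by blast+
  fix k assume k: "k \<in> carrier G"
  have "(\<lambda>m\<in>M. shift G g x (k \<otimes>\<^bsub>G\<^esub> m)) = (\<lambda>m\<in>M. x (inv\<^bsub>G\<^esub> g \<otimes>\<^bsub>G\<^esub> k \<otimes>\<^bsub>G\<^esub> m))"
    using M assms(3) k by (auto simp: shift_def restrict_def m_assoc subset_iff)
  then show "\<tau> (shift G g x) k = shift G g (\<tau> x) k"
    using eq[OF sh[OF assms(4)] k] eq[OF assms(4), of "inv\<^bsub>G\<^esub> g \<otimes>\<^bsub>G\<^esub> k"] assms(3) k
    by (simp add: shift_def)
qed

section \<open>Locally finite groups\<close>

text \<open>Sites in H read only sites in H, and sites outside H read none of them, so preimages of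
  \<open>y1\<close> and \<open>y2\<close> can be spliced along H; injectivity then fixes the value
  at the identity.\<close>

lemma inverse_local_on_cosets:
  assumes "group G" "subgroup H G" and M: "M \<subseteq> H"
    and bij: "bij_betw \<tau> (configurations G A) (configurations G A)"
    and eq: "\<And>x g. x \<in> configurations G A \<Longrightarrow> g \<in> carrier G \<Longrightarrow> \<tau> x g = \<mu> (\<lambda>m\<in>M. x (g \<otimes>\<^bsub>G\<^esub> m))"
    and y: "y1 \<in> configurations G A" "y2 \<in> configurations G A"
    and agree: "\<And>k. k \<in> H \<Longrightarrow> y1 k = y2 k"
  shows "the_inv_into (configurations G A) \<tau> y1 \<one>\<^bsub>G\<^esub> = the_inv_into (configurations G A) \<tau> y2 \<one>\<^bsub>G\<^esub>"
proof -
  interpret group G by fact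
  interpret H: subgroup H G by fact
  let ?C = "configurations G A"
  obtain x1 x2 where x: "x1 \<in> ?C" "x2 \<in> ?C" "y1 = \<tau> x1" "y2 = \<tau> x2"
    using bij y unfolding bij_betw_def by blast
  define x where "x = (\<lambda>k\<in>carrier G. if k \<in> H then x2 k else x1 k)"
  have xC: "x \<in> ?C" using x by (auto simp: x_def configurations_def)
  have "\<tau> x = \<tau> x1"
  proof (rule configurations_eqI)
    show "\<tau> x \<in> ?C" "\<tau> x1 \<in> ?C" using bij xC x unfolding bij_betw_def by blast+
    fix k assume k: "k \<in> carrier G"
    show "\<tau> x k = \<tau> x1 k"
    proof (cases "k \<in> H")
      case True
      then have "(\<lambda>m\<in>M. x (k \<otimes>\<^bsub>G\<^esub> m)) = (\<lambda>m\<in>M. x2 (k \<otimes>\<^bsub>G\<^esub> m))"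
        using M by (auto simp: x_def restrict_def subset_iff)
      then have "\<tau> x k = \<tau> x2 k" using eq[OF xC k] eq[OF x(2) k] by simp
      then show ?thesis using agree[OF True] x by simp
    next
      case False
      have "k \<otimes>\<^bsub>G\<^esub> m \<notin> H" if "m \<in> M" for m
      proof
        assume "k \<otimes>\<^bsub>G\<^esub> m \<in> H"
        then have "k \<otimes>\<^bsub>G\<^esub> m \<otimes>\<^bsub>G\<^esub> inv\<^bsub>G\<^esub> m \<in> H" using that M by auto
        moreover have "m \<in> carrier G" using that M by auto
        ultimately show False using False k by (simp add: m_assoc)
      qed
      then have "(\<lambda>m\<in>M. x (k \<otimes>\<^bsub>G\<^esub> m)) = (\<lambda>m\<in>M. x1 (k \<otimes>\<^bsub>G\<^esub> m))"
        using M k by (auto simp: x_def restrict_def subset_iff)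
      then show ?thesis using eq[OF xC k] eq[OF x(1) k] by simp
    qed
  qed
  then have "x = x1" using bij xC x(1) unfolding bij_betw_def inj_on_def by blast
  moreover have "x \<one>\<^bsub>G\<^esub> = x2 \<one>\<^bsub>G\<^esub>" by (simp add: x_def)
  ultimately have "x1 \<one>\<^bsub>G\<^esub> = x2 \<one>\<^bsub>G\<^esub>" by simp
  then show ?thesis using bij x by (simp add: bij_betw_def the_inv_into_f_f)
qed

lemma reversible_if_locally_finite:
  assumes "group G" "locally_finite G" "A \<noteq> {}" "bijective_cellular_automaton G A \<tau>"
  shows "reversible G A \<tau>"
proof -
  interpret group G by fact
  let ?C = "configurations G A"
  define \<sigma> where "\<sigma> = the_inv_into ?C \<tau>"
  have ca: "cellular_automaton G A \<tau>" and bij: "bij_betw \<tau> ?C ?C"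
    using assms(4) by (auto simp: bijective_cellular_automaton_def)
  from ca obtain M \<mu> where M: "finite M" "M \<subseteq> carrier G"
    and eq: "\<And>x g. x \<in> ?C \<Longrightarrow> g \<in> carrier G \<Longrightarrow> \<tau> x g = \<mu> (\<lambda>m\<in>M. x (g \<otimes>\<^bsub>G\<^esub> m))"
    by (auto simp: cellular_automaton_iff[OF assms(1)])
  define H where "H = generate G M"
  have sub: "subgroup H G" unfolding H_def using M by (simp add: generate_is_subgroup)
  have MH: "M \<subseteq> H" unfolding H_def by (auto intro: generate.incl)
  have HG: "H \<subseteq> carrier G" using sub by (rule subgroup.subset)
  have finH: "finite H"
    using assms(2) sub M unfolding locally_finite_def finitely_generated_subgroup_def H_def by blast
  obtain a where a: "a \<in> A" using assms(3) by blast
  have \<sigma>C: "\<sigma> y \<in> ?C" "\<tau> (\<sigma> y) = y" if "y \<in> ?C" for y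
    using bij that the_inv_into_into[of \<tau> ?C y ?C] f_the_inv_into_f[of \<tau> ?C y]
    unfolding \<sigma>_def bij_betw_def by auto
  have \<sigma>\<tau>: "\<sigma> (\<tau> x) = x" if "x \<in> ?C" for x
    using bij that unfolding \<sigma>_def bij_betw_def by (simp add: the_inv_into_f_f)
  \<comment> \<open>Applying \<sigma> to \<tau> (shift g (\<sigma> y)) = shift g y transfers
    equivariance from \<tau> to its inverse.\<close>
  have \<sigma>_shift: "\<sigma> (shift G g y) = shift G g (\<sigma> y)" if "g \<in> carrier G" "y \<in> ?C" for g y
    using cellular_automaton_shift[OF assms(1) ca that(1) \<sigma>C(1)[OF that(2)]] \<sigma>C(2)[OF that(2)]
      \<sigma>\<tau>[OF shift_configurations[OF assms(1) that(1) \<sigma>C(1)[OF that(2)]]] by simp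
  \<comment> \<open>The filler letter \<open>a\<close> is arbitrary: by
    \<open>inverse_local_on_cosets\<close> it does not affect the value of \<sigma> at the
    identity.\<close>
  define ext where "ext p = (\<lambda>k\<in>carrier G. if k \<in> H then p k else a)" for p
  have extC: "ext p \<in> ?C" if "p \<in> H \<rightarrow>\<^sub>E A" for p
    using that a by (auto simp: ext_def configurations_def)
  define \<nu> where "\<nu> p = \<sigma> (ext p) \<one>\<^bsub>G\<^esub>" for p
  have "\<sigma> y g = \<nu> (\<lambda>m\<in>H. y (g \<otimes>\<^bsub>G\<^esub> m))" if y: "y \<in> ?C" and g: "g \<in> carrier G" for y g
  proof -
    let ?z = "shift G (inv\<^bsub>G\<^esub> g) y" and ?p = "\<lambda>m\<in>H. y (g \<otimes>\<^bsub>G\<^esub> m)"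
    have z: "?z \<in> ?C" using assms(1) g y by (simp add: shift_configurations)
    have p: "?p \<in> H \<rightarrow>\<^sub>E A" using y g HG by (auto simp: configurations_def)
    have "\<sigma> y g = shift G (inv\<^bsub>G\<^esub> g) (\<sigma> y) \<one>\<^bsub>G\<^esub>" using g by (simp add: shift_def)
    also have "\<dots> = \<sigma> ?z \<one>\<^bsub>G\<^esub>" using \<sigma>_shift g y by simp
    also have "\<dots> = \<sigma> (ext ?p) \<one>\<^bsub>G\<^esub>"
      unfolding \<sigma>_def using HG g
      by (intro inverse_local_on_cosets[OF assms(1) sub MH bij eq z extC[OF p]])
         (auto simp: ext_def shift_def)
    finally show ?thesis by (simp add: \<nu>_def)
  qed
  moreover have "\<nu> \<in> (H \<rightarrow>\<^sub>E A) \<rightarrow> A"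
    using \<sigma>C(1)[OF extC] unfolding \<nu>_def configurations_def by blast
  ultimately have "cellular_automaton G A \<sigma>"
    unfolding cellular_automaton_iff[OF assms(1)] using finH HG \<sigma>C(1) by blast
  then show ?thesis using assms(4) by (simp add: reversible_def \<sigma>_def)
qed

section \<open>Balls in a finitely generated subgroup\<close>

text \<open>The ball about the identity in the Cayley graph with edges from g to g t: the products
  of at most k elements of T.\<close>

fun ball :: "('g, 'm) monoid_scheme \<Rightarrow> 'g set \<Rightarrow> nat \<Rightarrow> 'g set" where
  "ball G T 0 = {\<one>\<^bsub>G\<^esub>}"
| "ball G T (Suc k) = ball G T k \<union> {g \<otimes>\<^bsub>G\<^esub> t | g t. g \<in> ball G T k \<and> t \<in> T}"

lemma ball_mono: "j \<le> k \<Longrightarrow> ball G T j \<subseteq> ball G T k"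
  by (induction rule: dec_induct) auto

lemma ball_carrier:
  assumes "group G" "T \<subseteq> carrier G"
  shows "ball G T k \<subseteq> carrier G"
proof -
  interpret group G by fact
  show ?thesis using assms(2) by (induction k) auto
qed

lemma generate_subset_balls:
  assumes "group G" "S \<subseteq> carrier G" "h \<in> generate G S"
  shows "\<exists>k. h \<in> ball G (S \<union> (\<lambda>s. inv\<^bsub>G\<^esub> s) ` S) k"
proof -
  interpret group G by fact
  let ?T = "S \<union> (\<lambda>s. inv\<^bsub>G\<^esub> s) ` S"
  have T: "?T \<subseteq> carrier G" using assms(2) by auto
  have step: "\<exists>m. g \<otimes>\<^bsub>G\<^esub> t \<in> ball G ?T m" if "g \<in> ball G ?T k" "t \<in> ?T" for g t k
    using that by (intro exI[of _ "Suc k"]) auto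
  \<comment> \<open>The starting point g is arbitrary so that the product case can move g by
    \<open>h1\<close> first and then g \<open>h1\<close> by \<open>h2\<close>.\<close>
  from assms(3) have "\<And>k g. g \<in> ball G ?T k \<Longrightarrow> \<exists>m. g \<otimes>\<^bsub>G\<^esub> h \<in> ball G ?T m"
  proof induction
    case one
    then show ?case using ball_carrier[OF assms(1) T] by (metis r_one subsetD)
  next
    case (incl s)
    then show ?case using step by blast
  next
    case (inv s)
    then show ?case using step by blast
  next
    case (eng h1 h2)
    from eng.IH(1)[OF eng.prems] obtain m where "g \<otimes>\<^bsub>G\<^esub> h1 \<in> ball G ?T m" by blast
    from eng.IH(2)[OF this] show ?case
      using eng.hyps eng.prems generate_in_carrier[OF assms(2)] ball_carrier[OF assms(1) T]
      by (metis m_assoc subsetD)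
  qed
  from this[of "\<one>\<^bsub>G\<^esub>" 0] show ?thesis
    using generate_in_carrier[OF assms(2,3)] by auto
qed

section \<open>The flip automaton\<close>

locale flip_automaton = group G for G :: "('g, 'm) monoid_scheme" (structure) +
  fixes T :: "'g set" and A :: "'a set" and letter :: "nat \<times> bool \<Rightarrow> 'a"
  assumes T_carrier: "T \<subseteq> carrier G"
    and finite_T: "finite T"
    and inj_letter: "inj letter"
    and letter_A: "range letter \<subseteq> A"
begin

text \<open>Letters outside the range of \<open>letter\<close> are inert: at height 0 there is no
  lower site to trigger a flip, a false bit triggers none, and \<open>flip\<close> fixes
  them.\<close>

definition height :: "'a \<Rightarrow> nat" where
  "height a = (if a \<in> range letter then fst (inv_into UNIV letter a) else 0)"

definition bit :: "'a \<Rightarrow> bool" where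
  "bit a \<longleftrightarrow> a \<in> range letter \<and> snd (inv_into UNIV letter a)"

definition flip :: "'a \<Rightarrow> 'a" where
  "flip a = (if a \<in> range letter then letter (height a, \<not> bit a) else a)"

lemma height_letter [simp]: "height (letter (n, b)) = n"
  and bit_letter [simp]: "bit (letter (n, b)) = b"
  using inj_letter by (simp_all add: height_def bit_def)

lemma flip_letter [simp]: "flip (letter (n, b)) = letter (n, \<not> b)"
  by (simp add: flip_def)

lemma height_flip [simp]: "height (flip a) = height a"
  by (simp add: flip_def)

lemma flip_flip [simp]: "flip (flip a) = a"
proof (cases "a \<in> range letter")
  case True
  then obtain n b where "a = letter (n, b)" by auto
  then show ?thesis by simp
qed (simp add: flip_def)

lemma flip_A: "a \<in> A \<Longrightarrow> flip a \<in> A"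
  using letter_A by (auto simp: flip_def)

definition step :: "('g \<Rightarrow> 'a) \<Rightarrow> 'g \<Rightarrow> 'a" where
  "step x = (\<lambda>g\<in>carrier G.
     if \<exists>t\<in>T. height (x (g \<otimes> t)) < height (x g) \<and> bit (x (g \<otimes> t)) then flip (x g) else x g)"

text \<open>With \<open>conj_cong\<close> the recursive call comes under the assumption that the
  height at g t is smaller, which is what termination rests on.\<close>

context
  notes conj_cong [fundef_cong]
begin

text \<open>Heights may be read from y because the automaton preserves them; the bits that triggered
  the flips are those of the preimage, hence the recursive call.\<close>

function unstep_at :: "('g \<Rightarrow> 'a) \<Rightarrow> 'g \<Rightarrow> 'a" where
  "unstep_at y g =
     (if \<exists>t\<in>T. height (y (g \<otimes> t)) < height (y g) \<and> bit (unstep_at y (g \<otimes> t))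
      then flip (y g) else y g)"
  by auto
termination by (relation "measure (\<lambda>(y, g). height (y g))") auto

end

declare unstep_at.simps [simp del]

definition unstep :: "('g \<Rightarrow> 'a) \<Rightarrow> 'g \<Rightarrow> 'a" where
  "unstep y = restrict (unstep_at y) (carrier G)"

lemma height_step: "g \<in> carrier G \<Longrightarrow> height (step x g) = height (x g)"
  by (simp add: step_def)

lemma height_unstep: "g \<in> carrier G \<Longrightarrow> height (unstep y g) = height (y g)"
  by (simp add: unstep_def unstep_at.simps[of y g])

lemma unstep_eq:
  assumes "g \<in> carrier G"
  shows "unstep y g =
    (if \<exists>t\<in>T. height (y (g \<otimes> t)) < height (y g) \<and> bit (unstep y (g \<otimes> t))
     then flip (y g) else y g)"
proof -
  have "g \<otimes> t \<in> carrier G" if "t \<in> T" for t using that assms T_carrier by blast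
  then show ?thesis
    using assms by (simp add: unstep_def unstep_at.simps[of y g] cong: bex_cong)
qed

lemma step_configurations: "x \<in> configurations G A \<Longrightarrow> step x \<in> configurations G A"
  by (auto simp: step_def configurations_def PiE_iff flip_A)

lemma unstep_configurations: "y \<in> configurations G A \<Longrightarrow> unstep y \<in> configurations G A"
  unfolding unstep_def configurations_def
  by (auto simp: PiE_iff) (subst unstep_at.simps, simp add: flip_A)

text \<open>Since heights agree, \<open>step\<close> tests at g exactly the condition by which
  \<open>unstep\<close> decided to flip, so each site is flipped twice or not at all.\<close>

lemma step_unstep:
  assumes "y \<in> configurations G A"
  shows "step (unstep y) = y"
proof (rule configurations_eqI)
  show "step (unstep y) \<in> configurations G A" "y \<in> configurations G A"
    using assms by (simp_all add: step_configurations unstep_configurations)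
  fix g assume g: "g \<in> carrier G"
  then have gt: "g \<otimes> t \<in> carrier G" if "t \<in> T" for t using that T_carrier by blast
  let ?P = "\<exists>t\<in>T. height (y (g \<otimes> t)) < height (y g) \<and> bit (unstep y (g \<otimes> t))"
  have "step (unstep y) g = (if ?P then flip (unstep y g) else unstep y g)"
    using g gt by (simp add: step_def height_unstep cong: bex_cong)
  moreover have "unstep y g = (if ?P then flip (y g) else y g)" by (rule unstep_eq[OF g])
  ultimately show "step (unstep y) g = y g" by (cases ?P) (simp_all only: if_True if_False flip_flip)
qed

text \<open>Induction on the height at g: lower neighbours are already restored, so
  \<open>unstep\<close> repeats the test made by \<open>step\<close> and cancels its flip.\<close>

lemma unstep_step:
  assumes "x \<in> configurations G A"
  shows "unstep (step x) = x"
proof (rule configurations_eqI)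
  show "unstep (step x) \<in> configurations G A" "x \<in> configurations G A"
    using assms by (simp_all add: step_configurations unstep_configurations)
  fix g assume "g \<in> carrier G"
  then show "unstep (step x) g = x g"
  proof (induction "height (x g)" arbitrary: g rule: less_induct)
    case less
    then have gt: "g \<otimes> t \<in> carrier G" if "t \<in> T" for t using that T_carrier by blast
    let ?P = "\<exists>t\<in>T. height (x (g \<otimes> t)) < height (x g) \<and> bit (x (g \<otimes> t))"
    have "unstep (step x) g = (if ?P then flip (step x g) else step x g)"
      using less.prems less.hyps gt
      by (simp add: unstep_eq[OF less.prems] height_step cong: bex_cong conj_cong)
    moreover have "step x g = (if ?P then flip (x g) else x g)"
      using less.prems unfolding step_def by (rule restrict_apply')
    ultimately show ?case by (cases ?P) (simp_all only: if_True if_False flip_flip)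
  qed
qed

lemma bij_step: "bij_betw step (configurations G A) (configurations G A)"
  by (rule bij_betw_byWitness[of _ unstep])
     (auto simp: step_unstep unstep_step step_configurations unstep_configurations)

lemma cellular_automaton_step: "cellular_automaton G A step"
proof -
  let ?M = "insert \<one> T"
  define \<mu> where "\<mu> p =
    (if \<exists>t\<in>T. height (p t) < height (p \<one>) \<and> bit (p t) then flip (p \<one>) else p \<one>)" for p
  have "step x g = \<mu> (\<lambda>m\<in>?M. x (g \<otimes> m))" if "g \<in> carrier G" for x g
    using that by (auto simp: step_def \<mu>_def)
  moreover have "\<mu> \<in> (?M \<rightarrow>\<^sub>E A) \<rightarrow> A" by (auto simp: \<mu>_def PiE_iff flip_A)
  ultimately show ?thesis
    unfolding cellular_automaton_iff[OF is_group]
    using finite_T T_carrier step_configurations by (intro conjI exI[of _ ?M] exI[of _ \<mu>]) auto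
qed

lemma bijective_cellular_automaton_step: "bijective_cellular_automaton G A step"
  by (simp add: bijective_cellular_automaton_def cellular_automaton_step bij_step)

lemma step_eq_self:
  assumes "x \<in> configurations G A" "\<And>g. g \<in> carrier G \<Longrightarrow> \<not> bit (x g)"
  shows "step x = x"
proof (rule configurations_eqI)
  fix g assume g: "g \<in> carrier G"
  then have "\<not> bit (x (g \<otimes> t))" if "t \<in> T" for t
    using assms(2)[of "g \<otimes> t"] that T_carrier by blast
  then show "step x g = x g" using g by (simp add: step_def)
qed (use assms step_configurations in auto)

section \<open>Transport of a bit along a geodesic\<close>

text \<open>This is max(0, n + 1 - |g|) for the word length |g| over T: it falls from n + 1 at the
  identity to 0 outside the ball of radius n.\<close>

definition depth :: "nat \<Rightarrow> 'g \<Rightarrow> nat" where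
  "depth n g = card {j. j \<le> n \<and> g \<in> ball G T j}"

text \<open>Balls increase, so every ball containing g t but not contained in the ball of radius k
  contains g; the radius k itself counts for g and not for g t.\<close>

lemma depth_less:
  assumes "k \<le> n" "g \<in> ball G T k" "g \<otimes> t \<notin> ball G T k"
  shows "depth n (g \<otimes> t) < depth n g"
  unfolding depth_def
proof (rule psubset_card_mono)
  have "g \<in> ball G T j" if "g \<otimes> t \<in> ball G T j" for j
  proof -
    have "\<not> j \<le> k" using ball_mono[of j k G T] assms(3) that by blast
    then show ?thesis using ball_mono[of k j G T] assms(2) by auto
  qed
  then show "{j. j \<le> n \<and> g \<otimes> t \<in> ball G T j} \<subset> {j. j \<le> n \<and> g \<in> ball G T j}"
    using assms by auto
qed simp

text \<open>The hypotheses make k the word length of g. Its predecessor g' on a geodesic is higher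
  and has bit \<open>False\<close> in y, so a true bit recovered at g makes the bit recovered at g'
  true. Iterating reaches the identity.\<close>

lemma transport:
  assumes y: "y = (\<lambda>g\<in>carrier G. letter (depth n g, g = h))"
    and h: "h \<notin> ball G T n"
    and g: "g \<in> ball G T k" "bit (unstep y g)" "\<And>j. j < k \<Longrightarrow> g \<notin> ball G T j" "k \<le> Suc n"
  shows "bit (unstep y \<one>)"
  using g
proof (induction k arbitrary: g)
  case 0
  then show ?case by simp
next
  case (Suc k)
  then obtain g' t where g': "g' \<in> ball G T k" "t \<in> T" "g = g' \<otimes> t" by auto
  have car: "g' \<in> carrier G" "g \<in> carrier G"
    using g'(1) Suc.prems(1) ball_carrier[OF is_group T_carrier] by blast+
  have notin: "g \<notin> ball G T k" using Suc.prems(3) by simp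
  then have less: "depth n g < depth n g'"
    using depth_less[of k n g' t] g' Suc.prems(4) by simp
  \<comment> \<open>Here k \<le> n, so g' lies in the ball of radius n, which misses h.\<close>
  have "g' \<noteq> h" using g'(1) h ball_mono[of k n G T] Suc.prems(4) by auto
  then have "y g' = letter (depth n g', False)" using car y by simp
  moreover have "height (y g) < height (y g')" using less car y by simp
  then have "\<exists>t\<in>T. height (y (g' \<otimes> t)) < height (y g') \<and> bit (unstep y (g' \<otimes> t))"
    using g' Suc.prems(2) by blast
  ultimately have "bit (unstep y g')" by (simp add: unstep_eq[OF car(1)])
  \<comment> \<open>A shorter path to g' would give a shorter path to g, so g' has length exactly
    k.\<close>
  moreover have "g' \<notin> ball G T j" if "j < k" for j
  proof
    assume "g' \<in> ball G T j"
    then have "g \<in> ball G T (Suc j)" using g' by auto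
    then show False using Suc.prems(3)[of "Suc j"] that by simp
  qed
  ultimately show ?case using Suc.IH[of g'] g'(1) Suc.prems(4) by simp
qed

lemma not_cellular_automaton_inverse:
  assumes "infinite H" "\<And>h. h \<in> H \<Longrightarrow> \<exists>k. h \<in> ball G T k"
  shows "\<not> cellular_automaton G A (the_inv_into (configurations G A) step)"
proof
  let ?C = "configurations G A"
  assume "cellular_automaton G A (the_inv_into ?C step)"
  then obtain M \<mu> where M: "finite M" "M \<subseteq> carrier G"
    and eq: "\<And>x g. x \<in> ?C \<Longrightarrow> g \<in> carrier G \<Longrightarrow>
      the_inv_into ?C step x g = \<mu> (\<lambda>m\<in>M. x (g \<otimes> m))"
    by (auto simp: cellular_automaton_iff[OF is_group])
  have inv: "the_inv_into ?C step y = unstep y" if "y \<in> ?C" for y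
    using bij_step that unstep_configurations step_unstep
    by (intro the_inv_into_f_eq) (auto simp: bij_betw_def)
  \<comment> \<open>Avoiding M hides h from the local rule at the identity; avoiding the identity
    gives h positive length.\<close>
  obtain h where h: "h \<in> H" "h \<notin> insert \<one> M"
    using assms(1) M(1) by (meson finite.insertI finite_subset subsetI)
  define k where "k = (LEAST k. h \<in> ball G T k)"
  have hk: "h \<in> ball G T k" unfolding k_def using assms(2)[OF h(1)] by (rule LeastI_ex)
  have least: "h \<notin> ball G T j" if "j < k" for j
    using that unfolding k_def by (rule not_less_Least)
  have "k \<noteq> 0" using hk h(2) by (metis ball.simps(1) insertCI singletonD)
  \<comment> \<open>As h has length n + 1, it lies just outside the ball of radius n and gets depth
    0.\<close>
  then obtain n where n: "k = Suc n" using not0_implies_Suc by blast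
  have hG: "h \<in> carrier G" using hk ball_carrier[OF is_group T_carrier] by blast
  \<comment> \<open>The two configurations share all heights and differ only in the bit at
    h.\<close>
  define y1 where "y1 = (\<lambda>g\<in>carrier G. letter (depth n g, False))"
  define y2 where "y2 = (\<lambda>g\<in>carrier G. letter (depth n g, g = h))"
  have C: "y1 \<in> ?C" "y2 \<in> ?C"
    using letter_A by (auto simp: y1_def y2_def configurations_def)
  have "depth n h = 0" using least n by (auto simp: depth_def card_eq_0_iff)
  then have "height (y2 h) = 0" "bit (y2 h)" using hG by (simp_all add: y2_def)
  \<comment> \<open>Nothing is lower than height 0, so \<open>unstep\<close> leaves the letter at h
    alone.\<close>
  then have "bit (unstep y2 h)" by (simp add: unstep_eq[OF hG])
  then have "bit (unstep y2 \<one>)"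
    using transport[OF y2_def _ hk _ least] least n by simp
  moreover have "unstep y1 = y1"
    using unstep_step[OF C(1)] step_eq_self[OF C(1)] by (simp add: y1_def)
  then have "\<not> bit (unstep y1 \<one>)" by (simp add: y1_def)
  moreover have "y1 (\<one> \<otimes> m) = y2 (\<one> \<otimes> m)" if "m \<in> M" for m
  proof -
    have "m \<in> carrier G" "m \<noteq> h" using that M(2) h(2) by blast+
    then show ?thesis by (simp add: y1_def y2_def)
  qed
  then have "(\<lambda>m\<in>M. y1 (\<one> \<otimes> m)) = (\<lambda>m\<in>M. y2 (\<one> \<otimes> m))"
    by (rule restrict_ext)
  then have "unstep y1 \<one> = unstep y2 \<one>"
    using eq[OF C(1) one_closed] eq[OF C(2) one_closed] inv C by simp
  ultimately show False by simp
qed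

end

section \<open>The equivalences\<close>

lemma nonreversible_if_not_locally_finite:
  fixes A :: "'a set"
  assumes "group G" "\<not> locally_finite G" "infinite A"
  shows "\<exists>\<tau>. bijective_cellular_automaton G A \<tau> \<and>
    \<not> cellular_automaton G A (the_inv_into (configurations G A) \<tau>)"
proof -
  interpret group G by fact
  obtain S where S: "finite S" "S \<subseteq> carrier G" "infinite (generate G S)"
    using assms(2) by (auto simp: locally_finite_def finitely_generated_subgroup_def)
  obtain f :: "nat \<Rightarrow> 'a" where f: "inj f" "range f \<subseteq> A"
    using infinite_countable_subset[OF assms(3)] by blast
  \<comment> \<open>Closing S under inverses lets products of elements of \<open>?T\<close> exhaust
    the generated subgroup.\<close>
  let ?T = "S \<union> (\<lambda>s. inv\<^bsub>G\<^esub> s) ` S"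
  interpret flip_automaton G ?T A "f \<circ> to_nat"
    using S f by unfold_locales (auto intro: inj_compose)
  show ?thesis
    using bijective_cellular_automaton_step
      not_cellular_automaton_inverse[OF S(3) generate_subset_balls[OF assms(1) S(2)]] by blast
qed

lemma locally_finite_if_reversible:
  assumes "group G" "infinite A"
    and "\<And>\<tau>. bijective_cellular_automaton G A \<tau> \<Longrightarrow> reversible G A \<tau>"
  shows "locally_finite G"
  using nonreversible_if_not_locally_finite[OF assms(1) _ assms(2)] assms(3)
  unfolding reversible_def by blast

text \<open>Alphabets are subsets of a type. Infinite types supply \<open>UNIV\<close> as an
  infinite alphabet, to which the universal conditions are applied and which witnesses the
  existential one.\<close>

theorem theorem1p1:
  fixes G :: "('g, 'm) monoid_scheme"
  assumes "group G"
    and "infinite (UNIV :: 'a set)"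
    and "infinite (UNIV :: 'b set)"
    and "infinite (UNIV :: 'c set)"
  shows
    "(locally_finite G \<longleftrightarrow>
        (\<forall>A :: 'a set. A \<noteq> {} \<longrightarrow>
           (\<forall>\<tau>. bijective_cellular_automaton G A \<tau> \<longrightarrow> reversible G A \<tau>))) \<and>
     (locally_finite G \<longleftrightarrow>
        (\<forall>A :: 'b set. infinite A \<longrightarrow>
           (\<forall>\<tau>. bijective_cellular_automaton G A \<tau> \<longrightarrow> reversible G A \<tau>))) \<and>
     (locally_finite G \<longleftrightarrow>
        (\<exists>A :: 'c set. infinite A \<and>
           (\<forall>\<tau>. bijective_cellular_automaton G A \<tau> \<longrightarrow> reversible G A \<tau>))) \<and>
     (\<not> locally_finite G \<longrightarrow>
        (\<forall>A :: 'd set. infinite A \<longrightarrow>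
           (\<exists>\<tau>. bijective_cellular_automaton G A \<tau> \<and>
              \<not> cellular_automaton G A (the_inv_into (configurations G A) \<tau>))))"
proof (intro conjI iffI allI impI)
  have inf_nonempty: "A \<noteq> {}" if "infinite A" for A :: "'b set"
    using that by auto
  show "reversible G A \<tau>"
    if "locally_finite G" "A \<noteq> {}" "bijective_cellular_automaton G A \<tau>" for A :: "'a set" and \<tau>
    using that by (rule reversible_if_locally_finite[OF assms(1)])
  show "reversible G A \<tau>"
    if "locally_finite G" "infinite A" "bijective_cellular_automaton G A \<tau>" for A :: "'b set" and \<tau>
    using that by (intro reversible_if_locally_finite[OF assms(1)] inf_nonempty)
  show "\<exists>A :: 'c set. infinite A \<and>
      (\<forall>\<tau>. bijective_cellular_automaton G A \<tau> \<longrightarrow> reversible G A \<tau>)" if "locally_finite G"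
    using reversible_if_locally_finite[OF assms(1) that UNIV_not_empty] assms(4) by blast
  show "locally_finite G"
    if "\<forall>A :: 'a set. A \<noteq> {} \<longrightarrow>
      (\<forall>\<tau>. bijective_cellular_automaton G A \<tau> \<longrightarrow> reversible G A \<tau>)"
    using that assms(2) by (intro locally_finite_if_reversible[OF assms(1), of UNIV]) auto
  show "locally_finite G"
    if "\<forall>A :: 'b set. infinite A \<longrightarrow>
      (\<forall>\<tau>. bijective_cellular_automaton G A \<tau> \<longrightarrow> reversible G A \<tau>)"
    using that assms(3) by (intro locally_finite_if_reversible[OF assms(1), of UNIV]) auto
  show "locally_finite G"
    if "\<exists>A :: 'c set. infinite A \<and>
      (\<forall>\<tau>. bijective_cellular_automaton G A \<tau> \<longrightarrow> reversible G A \<tau>)"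
    using that locally_finite_if_reversible[OF assms(1)] by blast
  show "\<exists>\<tau>. bijective_cellular_automaton G A \<tau> \<and>
      \<not> cellular_automaton G A (the_inv_into (configurations G A) \<tau>)"
    if "\<not> locally_finite G" "infinite A" for A :: "'d set"
    using that by (rule nonreversible_if_not_locally_finite[OF assms(1)])
qed

end
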